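(* A (coloured symmetric) set-operad $P$ is canonically decomposable if and only if for any $P$-algebra $A$ and any elements $s,s'$ of $A$ each connected component of the category $\mathrm{Hom}_{\mathbb T_P(A)}(s,s')$ has an initial object.
   Context: Operads are coloured symmetric operads in sets with identity operations. **Canonical decomposability.** $P$ is canonically decomposable if there is a subset $P'$ of its operations such that for any operation $q$ of $P$ of arity $N\ge1$ there exist unique: $q'\in P'$ (of some arity $m+2$, $m\ge -1$), operations $q_0,\dots,q_m$ of $P$, and indices $j_{l1}<\dots<j_{lk_l}$ ($0\le l\le m$) partitioning $\{2,\dots,N\}$, such that $q(x_1,\dots,x_N)=q'(x_1,q_0(x_{j_{01}},\dots,x_{j_{0k_0}}),\dots,q_m(x_{j_{m1}},\dots,x_{j_{mk_m}}))$ (functional notation for operadic composition and relabelling of inputs). **The categories $\mathrm{Hom}_{\mathbb T_P(A)}(s,s')$** (the categories of morphisms of the strict $2$-category $\mathbb T_P(A)$ whose objects are the elements of $A$). For $s\in A(c)$, $s'\in A(c')$, objects are the tuples $(r;a_2,\dots,a_m)$, $m\ge1$, with $r\in P(c,c_2,\dots,c_m;c')$, $a_i\in A(c_i)$ and $r(s,a_2,\dots,a_m)=s'$. A morphism $(r;a_2,\dots,a_m)\to(r';a'_2,\dots,a'_{m'})$ is a tuple $(q_2,\dots,q_m;\lambda)$, where $q_i\in P$ has output colour $c_i$ and arity $k_i\ge0$, $\lambda$ is a bijection from $\{(i,k):2\le i\le m,1\le k\le k_i\}$ onto $\{2,\dots,m'\}$ increasing in $k$ for each fixed $i$, such that $r'(x_1,\dots,x_{m'})=r(x_1,q_2(x_{\lambda(2,1)},\dots,x_{\lambda(2,k_2)}),\dots,q_m(x_{\lambda(m,1)},\dots,x_{\lambda(m,k_m)}))$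 and $a_i=q_i(a'_{\lambda(i,1)},\dots,a'_{\lambda(i,k_i)})$ for all $i$. The composite of $(q_2,\dots,q_m;\lambda)$ followed by $(p_2,\dots,p_{m'};\mu)$ has operations $q_i(p_{\lambda(i,1)},\dots,p_{\lambda(i,k_i)})$ with inputs numbered by $\mu$ (and permuted so that the numbers increase). *)

theory Defs
  imports "HOL-Combinatorics.Multiset_Permutations"
begin

section \<open>Coloured symmetric operads in sets\<close>

text \<open>
  An operation \<open>f\<close> carries the list \<open>inp f\<close> of its input colours and its output colour \<open>out f\<close>, so
  \<open>P(c\<^sub>1, \<dots>, c\<^sub>n; c)\<close> is the set of all \<open>f \<in> ops P\<close> with \<open>inp f = [c\<^sub>1, \<dots>, c\<^sub>n]\<close> and \<open>out f = c\<close>.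
  Inputs are numbered from \<open>0\<close>.

  Composition is total: \<open>comp f [g\<^sub>0, \<dots>, g\<^sub>n\<^sub>-\<^sub>1]\<close> is \<open>f(g\<^sub>0(\<dots>), \<dots>, g\<^sub>n\<^sub>-\<^sub>1(\<dots>))\<close>, with the inputs of the
  \<open>g\<^sub>i\<close> taken consecutively.  The symmetric groups act by relabelling of inputs: for a list \<open>js\<close>
  enumerating \<open>{..<n}\<close> without repetition, \<open>relabel f js\<close> is the operation
  \<open>(x\<^sub>0, \<dots>, x\<^sub>n\<^sub>-\<^sub>1) \<mapsto> f(x\<^bsub>js!0\<^esub>, \<dots>, x\<^bsub>js!(n-1)\<^esub>)\<close>.
\<close>

record ('c, 'o) operad =
  colours :: "'c set"
  ops :: "'o set"
  inp :: "'o \<Rightarrow> 'c list"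
  out :: "'o \<Rightarrow> 'c"
  ident :: "'c \<Rightarrow> 'o"
  comp :: "'o \<Rightarrow> 'o list \<Rightarrow> 'o"
  relabel :: "'o \<Rightarrow> nat list \<Rightarrow> 'o"

definition arity :: "('c, 'o, 'x) operad_scheme \<Rightarrow> 'o \<Rightarrow> nat" where
  "arity P f = length (inp P f)"

definition composable :: "('c, 'o, 'x) operad_scheme \<Rightarrow> 'o \<Rightarrow> 'o list \<Rightarrow> bool" where
  "composable P f gs \<longleftrightarrow> f \<in> ops P \<and> set gs \<subseteq> ops P \<and> map (out P) gs = inp P f"

text \<open>
  \<open>blocks [n\<^sub>0, n\<^sub>1, \<dots>]\<close> splits \<open>0, 1, 2, \<dots>\<close> into consecutive intervals of lengths
  \<open>n\<^sub>0, n\<^sub>1, \<dots>\<close>; e.g. \<open>blocks [2, 0, 1] = [[0, 1], [], [2]]\<close>.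
\<close>

definition blocks :: "nat list \<Rightarrow> nat list list" where
  "blocks ns = map (\<lambda>i. [sum_list (take i ns)..<sum_list (take (Suc i) ns)]) [0..<length ns]"

locale symmetric_operad =
  fixes P :: "('c, 'o, 'x) operad_scheme" (structure)
  assumes out_colours: "f \<in> ops P \<Longrightarrow> out P f \<in> colours P"
    and inp_colours: "f \<in> ops P \<Longrightarrow> set (inp P f) \<subseteq> colours P"
    and ident_ops: "c \<in> colours P \<Longrightarrow> ident P c \<in> ops P"
    and inp_ident: "c \<in> colours P \<Longrightarrow> inp P (ident P c) = [c]"
    and out_ident: "c \<in> colours P \<Longrightarrow> out P (ident P c) = c"
    and comp_ops: "composable P f gs \<Longrightarrow> comp P f gs \<in> ops P"
    and inp_comp: "composable P f gs \<Longrightarrow> inp P (comp P f gs) = concat (map (inp P) gs)"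
    and out_comp: "composable P f gs \<Longrightarrow> out P (comp P f gs) = out P f"
    and relabel_ops: "\<lbrakk>f \<in> ops P; js \<in> permutations_of_set {..<arity P f}\<rbrakk> \<Longrightarrow>
      relabel P f js \<in> ops P"
    and arity_relabel: "\<lbrakk>f \<in> ops P; js \<in> permutations_of_set {..<arity P f}\<rbrakk> \<Longrightarrow>
      arity P (relabel P f js) = arity P f"
    and inp_relabel: "\<lbrakk>f \<in> ops P; js \<in> permutations_of_set {..<arity P f}\<rbrakk> \<Longrightarrow>
      map (\<lambda>j. inp P (relabel P f js) ! j) js = inp P f"
    and out_relabel: "\<lbrakk>f \<in> ops P; js \<in> permutations_of_set {..<arity P f}\<rbrakk> \<Longrightarrow>
      out P (relabel P f js) = out P f"
    and comp_ident_left: "f \<in> ops P \<Longrightarrow> comp P (ident P (out P f)) [f] = f"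
    and comp_ident_right: "f \<in> ops P \<Longrightarrow> comp P f (map (ident P) (inp P f)) = f"
    and comp_assoc: "\<lbrakk>composable P f gs; list_all2 (composable P) gs hss\<rbrakk> \<Longrightarrow>
      comp P (comp P f gs) (concat hss) = comp P f (map2 (comp P) gs hss)"
    and relabel_id: "f \<in> ops P \<Longrightarrow> relabel P f [0..<arity P f] = f"
    and relabel_relabel:
      "\<lbrakk>f \<in> ops P; js \<in> permutations_of_set {..<arity P f};
        ks \<in> permutations_of_set {..<arity P f}\<rbrakk> \<Longrightarrow>
      relabel P (relabel P f js) ks = relabel P f (map (\<lambda>j. ks ! j) js)"
    and comp_relabel_outer:
      "\<lbrakk>f \<in> ops P; js \<in> permutations_of_set {..<arity P f}; composable P (relabel P f js) gs\<rbrakk> \<Longrightarrow>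
      comp P (relabel P f js) gs =
        relabel P (comp P f (map (\<lambda>j. gs ! j) js))
          (concat (map (\<lambda>j. blocks (map (arity P) gs) ! j) js))"
    and comp_relabel_inner:
      "\<lbrakk>composable P f gs;
        list_all2 (\<lambda>g js. js \<in> permutations_of_set {..<arity P g}) gs jss\<rbrakk> \<Longrightarrow>
      comp P f (map2 (relabel P) gs jss) =
        relabel P (comp P f gs)
          (concat (map2 (\<lambda>b js. map (\<lambda>j. b ! j) js) (blocks (map (arity P) gs)) jss))"

record ('c, 'o, 'a) algebra =
  elts :: "'c \<Rightarrow> 'a set"
  app :: "'o \<Rightarrow> 'a list \<Rightarrow> 'a"

definition args ::
    "('c, 'o, 'x) operad_scheme \<Rightarrow> ('c, 'o, 'a, 'y) algebra_scheme \<Rightarrow> 'o \<Rightarrow> 'a list \<Rightarrow> bool" where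
  "args P A f xs \<longleftrightarrow> list_all2 (\<lambda>x c. x \<in> elts A c) xs (inp P f)"

locale operad_algebra = symmetric_operad P
  for P :: "('c, 'o, 'x) operad_scheme" (structure) +
  fixes A :: "('c, 'o, 'a, 'y) algebra_scheme"
  assumes app_elts: "\<lbrakk>f \<in> ops P; args P A f xs\<rbrakk> \<Longrightarrow> app A f xs \<in> elts A (out P f)"
    and app_ident: "\<lbrakk>c \<in> colours P; x \<in> elts A c\<rbrakk> \<Longrightarrow> app A (ident P c) [x] = x"
    and app_comp: "\<lbrakk>composable P f gs; list_all2 (args P A) gs xss\<rbrakk> \<Longrightarrow>
      app A (comp P f gs) (concat xss) = app A f (map2 (app A) gs xss)"
    and app_relabel:
      "\<lbrakk>f \<in> ops P; js \<in> permutations_of_set {..<arity P f}; args P A (relabel P f js) xs\<rbrakk> \<Longrightarrow>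
      app A (relabel P f js) xs = app A f (map (\<lambda>j. xs ! j) js)"


section \<open>Canonical decomposability\<close>

text \<open>
  For \<open>f\<close> of arity \<open>m + 1\<close>, \<open>graft P f [g\<^sub>1, \<dots>, g\<^sub>m] [js\<^sub>1, \<dots>, js\<^sub>m]\<close> is the operation
  \<open>f(x\<^sub>0, g\<^sub>1(x\<^bsub>js\<^sub>1!0\<^esub>, x\<^bsub>js\<^sub>1!1\<^esub>, \<dots>), \<dots>, g\<^sub>m(x\<^bsub>js\<^sub>m!0\<^esub>, x\<^bsub>js\<^sub>m!1\<^esub>, \<dots>))\<close>.
  It is meaningful when \<open>graftable P f gs jss N\<close> holds; \<open>N\<close> is then the arity of the result,
  and the increasing, possibly empty lists \<open>js\<^sub>i\<close> partition \<open>{1, \<dots>, N - 1}\<close>.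
\<close>

definition graft :: "('c, 'o, 'x) operad_scheme \<Rightarrow> 'o \<Rightarrow> 'o list \<Rightarrow> nat list list \<Rightarrow> 'o" where
  "graft P f gs jss = relabel P (comp P f (ident P (hd (inp P f)) # gs)) (0 # concat jss)"

definition graftable ::
    "('c, 'o, 'x) operad_scheme \<Rightarrow> 'o \<Rightarrow> 'o list \<Rightarrow> nat list list \<Rightarrow> nat \<Rightarrow> bool" where
  "graftable P f gs jss N \<longleftrightarrow>
     f \<in> ops P \<and> arity P f \<ge> 1 \<and> set gs \<subseteq> ops P \<and> map (out P) gs = tl (inp P f) \<and>
     map length jss = map (arity P) gs \<and> (\<forall>js\<in>set jss. sorted_wrt (<) js) \<and>
     N \<ge> 1 \<and> concat jss \<in> permutations_of_set {1..<N}"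

definition canonically_decomposable :: "('c, 'o, 'x) operad_scheme \<Rightarrow> bool" where
  "canonically_decomposable P \<longleftrightarrow>
     (\<exists>P' \<subseteq> ops P. \<forall>q \<in> ops P. arity P q \<ge> 1 \<longrightarrow>
        (\<exists>!d. case d of (q', qs, jss) \<Rightarrow>
           q' \<in> P' \<and> graftable P q' qs jss (arity P q) \<and> q = graft P q' qs jss))"


section \<open>Connected components and initial objects\<close>

record ('x, 'm) category =
  Obj :: "'x set"
  Hom :: "'x \<Rightarrow> 'x \<Rightarrow> 'm set"
  Id :: "'x \<Rightarrow> 'm"
  Comp :: "'m \<Rightarrow> 'm \<Rightarrow> 'm" \<comment> \<open>in diagrammatic order\<close>

definition connected_objs :: "('x, 'm, 'z) category_scheme \<Rightarrow> ('x \<times> 'x) set" where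
  "connected_objs C =
     {(X, Y). equivclp (\<lambda>X Y. X \<in> Obj C \<and> Y \<in> Obj C \<and> Hom C X Y \<noteq> {}) X Y}"

definition components :: "('x, 'm, 'z) category_scheme \<Rightarrow> 'x set set" where
  "components C = Obj C // connected_objs C"

definition full_subcategory ::
    "('x, 'm, 'z) category_scheme \<Rightarrow> 'x set \<Rightarrow> ('x, 'm, 'z) category_scheme" where
  "full_subcategory C K = C\<lparr>Obj := K\<rparr>"

definition initial :: "('x, 'm, 'z) category_scheme \<Rightarrow> 'x \<Rightarrow> bool" where
  "initial C I \<longleftrightarrow> I \<in> Obj C \<and> (\<forall>X \<in> Obj C. \<exists>!h. h \<in> Hom C I X)"


section \<open>The morphism categories of \<open>\<bbbT>\<^sub>P(A)\<close>\<close>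

text \<open>
  An object \<open>(r; a\<^sub>2, \<dots>, a\<^sub>m)\<close> is the pair of \<open>r\<close> and the list of the \<open>a\<^sub>i\<close>.  A morphism
  \<open>(q\<^sub>2, \<dots>, q\<^sub>m; \<lambda>)\<close> is a pair of lists \<open>(qs, jss)\<close>, where the \<open>i\<close>-th entry of \<open>jss\<close> lists the values
  \<open>\<lambda>(i,1) < \<lambda>(i,2) < \<dots>\<close>, lowered by one because inputs are numbered from \<open>0\<close>.  Thus input \<open>j \<ge> 1\<close>
  of the operation of an object \<open>(r, xs)\<close> receives \<open>xs ! (j - 1)\<close>.
\<close>

definition T_obj ::
    "('c, 'o, 'x) operad_scheme \<Rightarrow> ('c, 'o, 'a, 'y) algebra_scheme \<Rightarrow>
     'c \<Rightarrow> 'a \<Rightarrow> 'c \<Rightarrow> 'a \<Rightarrow> ('o \<times> 'a list) set" where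
  "T_obj P A c s c' s' =
     {(r, xs). r \<in> ops P \<and> (\<exists>cs. inp P r = c # cs) \<and> out P r = c' \<and>
        args P A r (s # xs) \<and> app A r (s # xs) = s'}"

definition T_mor ::
    "('c, 'o, 'x) operad_scheme \<Rightarrow> ('c, 'o, 'a, 'y) algebra_scheme \<Rightarrow>
     'o \<times> 'a list \<Rightarrow> 'o \<times> 'a list \<Rightarrow> ('o list \<times> nat list list) set" where
  "T_mor P A X Y =
     (case (X, Y) of ((r, xs), (r', xs')) \<Rightarrow>
       {(qs, jss). graftable P r qs jss (arity P r') \<and> r' = graft P r qs jss \<and>
          xs = map2 (\<lambda>q js. app A q (map (\<lambda>j. xs' ! (j - 1)) js)) qs jss})"

definition T_id :: "('c, 'o, 'x) operad_scheme \<Rightarrow> 'o \<times> 'a list \<Rightarrow> 'o list \<times> nat list list" where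
  "T_id P X = (map (ident P) (tl (inp P (fst X))), map (\<lambda>j. [j]) [1..<arity P (fst X)])"

text \<open>
  \<open>rank L\<close> replaces each entry of \<open>L\<close> by its position in \<open>sort L\<close>, so that
  \<open>relabel h (rank L)\<close> applied to the arguments numbered \<open>sort L\<close> is \<open>h\<close> applied to those numbered \<open>L\<close>.
\<close>

definition rank :: "nat list \<Rightarrow> nat list" where
  "rank L = map (\<lambda>l. card {l' \<in> set L. l' < l}) L"

definition T_comp ::
    "('c, 'o, 'x) operad_scheme \<Rightarrow> 'o list \<times> nat list list \<Rightarrow> 'o list \<times> nat list list \<Rightarrow>
     'o list \<times> nat list list" where
  "T_comp P u v =
     (case (u, v) of ((qs, jss), (ps, kss)) \<Rightarrow>
        let Ls = map (\<lambda>js. concat (map (\<lambda>j. kss ! (j - 1)) js)) jss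
        in (map2 (\<lambda>h L. relabel P h (rank L))
              (map2 (\<lambda>q js. comp P q (map (\<lambda>j. ps ! (j - 1)) js)) qs jss) Ls,
            map sort Ls))"

definition T_Hom ::
    "('c, 'o, 'x) operad_scheme \<Rightarrow> ('c, 'o, 'a, 'y) algebra_scheme \<Rightarrow> 'c \<Rightarrow> 'a \<Rightarrow> 'c \<Rightarrow> 'a \<Rightarrow>
     ('o \<times> 'a list, 'o list \<times> nat list list) category" where
  "T_Hom P A c s c' s' =
     \<lparr>Obj = T_obj P A c s c' s', Hom = T_mor P A, Id = T_id P, Comp = T_comp P\<rparr>"

end

theory Submission
  imports Defs
begin

text \<open>
  Objects and morphisms of the categories of the statement record grafts: a morphism
  \<open>(r, xs) \<rightarrow> (t, ys)\<close> is a way of writing \<open>t\<close> as a graft with base \<open>r\<close>, and it determines \<open>xs\<close> from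
  \<open>ys\<close>.  Conversely every such graft lifts to a morphism (\<open>graft_lifts_to_T_mor\<close>).

  Suppose that every operation with an input is uniquely a graft whose base lies in \<open>P'\<close>.  Then every object \<open>X\<close>
  receives exactly one morphism from an object with operation in \<open>P'\<close>, the canonical source of \<open>X\<close>.
  As morphisms compose (\<open>T_comp_in_T_mor\<close>), a morphism \<open>X \<rightarrow> Y\<close> makes the canonical source of \<open>X\<close> one
  of \<open>Y\<close> too, so by uniqueness it is constant on a connected component, where it is initial
  (\<open>component_has_initial\<close>).

  For the converse it suffices to look at the terminal algebra, with exactly one element of each
  colour.  This algebra exists over any type of elements, because types are inhabited.  There an
  object is just an operation with at least one input, and a morphism to it is precisely a way of
  presenting it as a graft.  Choose one initial object in each component and let \<open>P'\<close> consist of the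
  chosen operations.  A presentation of \<open>q\<close> with base in \<open>P'\<close> is a morphism to \<open>q\<close> from a chosen
  object, which then is the one of the component of \<open>q\<close>; initiality gives existence and uniqueness
  (\<open>initial_imp_canonically_decomposable\<close>).

  The technical core is that grafts compose, where the relabellings have to be tracked through
  operadic composition.  This is done for the more symmetric operation \<open>wire\<close>, which is associative
  (\<open>wire_wire\<close>) and does not change when the inputs of an inner operation are sorted (\<open>wire_sort\<close>).
\<close>

section \<open>Lists, blocks and ranks\<close>

lemma permutations_of_lessThan_iff_mset:
  "xs \<in> permutations_of_set {..<n} \<longleftrightarrow> mset xs = mset [0..<n]"
proof
  assume "xs \<in> permutations_of_set {..<n}"
  then have xs: "set xs = {..<n}" "distinct xs"
    by (simp_all add: permutations_of_set_def)
  have "set xs = set [0..<n]" using xs(1) by (simp add: atLeast0LessThan)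
  then show "mset xs = mset [0..<n]"
    by (rule iffD1[OF set_eq_iff_mset_eq_distinct[OF xs(2) distinct_upt]])
next
  assume eq: "mset xs = mset [0..<n]"
  have "distinct xs" using mset_eq_imp_distinct_iff[OF eq] distinct_upt by blast
  moreover have "set xs = {..<n}" using mset_eq_setD[OF eq] by (simp add: atLeast0LessThan)
  ultimately show "xs \<in> permutations_of_set {..<n}"
    by (simp add: permutations_of_set_def)
qed

lemma map_nth_permutation:
  assumes "js \<in> permutations_of_set {..<length xs}"
  shows "mset (map ((!) xs) js) = mset xs"
proof -
  have "mset (map ((!) xs) js) = image_mset ((!) xs) (mset [0..<length xs])"
    using assms by (simp add: permutations_of_lessThan_iff_mset)
  also have "\<dots> = mset (map ((!) xs) [0..<length xs])" by simp
  finally show ?thesis by (simp only: map_nth)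
qed

lemma mset_concat_cong: "map mset xss = map mset yss \<Longrightarrow> mset (concat xss) = mset (concat yss)"
  by (simp add: mset_concat)

lemma mset_concat_reorder: "mset xss = mset yss \<Longrightarrow> mset (concat xss) = mset (concat yss)"
  by (metis mset_concat mset_map sum_mset_sum_list)

lemma length_blocks [simp]: "length (blocks ns) = length ns"
  by (simp add: blocks_def)

lemma length_nth_blocks: "i < length ns \<Longrightarrow> length (blocks ns ! i) = ns ! i"
  by (simp add: blocks_def take_Suc_conv_app_nth)

lemma blocks_Cons: "blocks (n # ns) = [0..<n] # map (map ((+) n)) (blocks ns)"
proof -
  have shift: "map ((+) n) [a..<b] = [n + a..<n + b]" for a b
    by (auto intro: nth_equalityI)
  show ?thesis
  proof (rule nth_equalityI)
    fix i assume "i < length (blocks (n # ns))"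
    then show "blocks (n # ns) ! i = ([0..<n] # map (map ((+) n)) (blocks ns)) ! i"
      by (cases i) (auto simp: blocks_def shift nth_append simp del: upt_Suc)
  qed (simp add: blocks_def)
qed

lemma concat_blocks: "concat (blocks ns) = [0..<sum_list ns]"
proof (induction ns)
  case Nil
  then show ?case by (simp add: blocks_def)
next
  case (Cons n ns)
  then have "concat (blocks (n # ns)) = [0..<n] @ map ((+) n) [0..<sum_list ns]"
    by (simp add: blocks_Cons flip: map_concat)
  also have "map ((+) n) [0..<sum_list ns] = [n..<n + sum_list ns]"
    by (auto intro: nth_equalityI)
  finally show ?case using upt_add_eq_append[of 0 n "sum_list ns"] by simp
qed

text \<open>
  Blocks are the positions of the pieces inside a concatenation: reading off the entries there
  recovers the pieces.  This is how composites of relabellings by concatenated lists are computed.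
\<close>

lemma map_nth_concat_blocks:
  "map (map ((!) (concat xss))) (blocks (map length xss)) = xss"
proof (induction xss)
  case Nil
  then show ?case by (simp add: blocks_def)
next
  case (Cons xs xss)
  have 1: "map ((!) (xs @ concat xss)) [0..<length xs] = xs"
    by (rule nth_equalityI) (auto simp: nth_append)
  have 2: "(!) (xs @ concat xss) \<circ> (+) (length xs) = (!) (concat xss)"
    by (rule ext) (simp add: nth_append)
  show ?case using 1 Cons.IH by (simp add: blocks_Cons 2)
qed

lemma map_nth_concat_block:
  assumes "map length xss = ns" "i < length ns"
  shows "map ((!) (concat xss)) (blocks ns ! i) = xss ! i"
proof -
  have "map (map ((!) (concat xss))) (blocks ns) ! i = xss ! i"
    using map_nth_concat_blocks[of xss] assms(1) by simp
  then show ?thesis using assms(2) by simp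
qed

lemma card_less_sort_nth:
  assumes "distinct L" "i < length L"
  shows "card {l' \<in> set L. l' < sort L ! i} = i"
proof -
  have sorted: "sorted_wrt (<) (sort L)"
    using assms(1) by (simp add: strict_sorted_iff)
  have "{l' \<in> set L. l' < sort L ! i} = (!) (sort L) ` {..<i}"
  proof (intro equalityI subsetI)
    fix l assume "l \<in> {l' \<in> set L. l' < sort L ! i}"
    then obtain k where k: "k < length L" "l = sort L ! k" "sort L ! k < sort L ! i"
      by (metis (mono_tags, lifting) in_set_conv_nth length_sort mem_Collect_eq set_sort)
    have "k < i"
    proof (rule ccontr)
      assume "\<not> k < i"
      then have "sort L ! i \<le> sort L ! k"
        using k(1) by (intro sorted_nth_mono) auto
      with k(3) show False by simp
    qed
    with k(2) show "l \<in> (!) (sort L) ` {..<i}" by auto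
  next
    fix l assume "l \<in> (!) (sort L) ` {..<i}"
    then obtain k where k: "k < i" "l = sort L ! k" by auto
    then have "l < sort L ! i"
      using sorted assms(2) by (simp add: sorted_wrt_iff_nth_less)
    moreover have "l \<in> set L"
      using k assms(2) by (metis length_sort nth_mem order.strict_trans set_sort)
    ultimately show "l \<in> {l' \<in> set L. l' < sort L ! i}" by simp
  qed
  moreover have "inj_on ((!) (sort L)) {..<i}"
    using assms by (intro inj_on_nth) auto
  ultimately show ?thesis by (simp add: card_image)
qed

lemma length_rank [simp]: "length (rank L) = length L"
  by (simp add: rank_def)

lemma rank_permutation:
  assumes "distinct L"
  shows "rank L \<in> permutations_of_set {..<length L}"
proof -
  have "mset (rank L) = image_mset (\<lambda>l. card {l' \<in> set L. l' < l}) (mset (sort L))"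
    by (simp add: rank_def)
  also have "\<dots> = mset (map (\<lambda>l. card {l' \<in> set L. l' < l}) (sort L))"
    by simp
  also have "map (\<lambda>l. card {l' \<in> set L. l' < l}) (sort L) = [0..<length L]"
    using assms by (intro nth_equalityI) (auto simp: card_less_sort_nth)
  finally show ?thesis by (simp add: permutations_of_lessThan_iff_mset)
qed

text \<open>
  The number of smaller entries is the position in the sorted list, so reading the sorted list at
  the ranks restores the original order.
\<close>

lemma map_sort_nth_rank:
  assumes "distinct L"
  shows "map ((!) (sort L)) (rank L) = L"
proof -
  have "sort L ! card {l' \<in> set L. l' < l} = l" if l: "l \<in> set L" for l
  proof -
    obtain i where "i < length L" "l = sort L ! i"
      using l by (metis in_set_conv_nth length_sort set_sort)
    then show ?thesis using assms by (simp add: card_less_sort_nth)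
  qed
  then show ?thesis by (simp add: rank_def map_idI)
qed

lemma rank_singleton: "rank [l] = [0]"
  by (simp add: rank_def)


section \<open>Wired composites\<close>

text \<open>
  \<open>wire P f [g\<^sub>0, \<dots>, g\<^sub>n] [L\<^sub>0, \<dots>, L\<^sub>n]\<close> is \<open>f(g\<^sub>0(x\<^bsub>L\<^sub>0!0\<^esub>, x\<^bsub>L\<^sub>0!1\<^esub>, \<dots>), \<dots>, g\<^sub>n(x\<^bsub>L\<^sub>n!0\<^esub>, \<dots>))\<close>.
  Grafting is the special case in which \<open>g\<^sub>0\<close> is an identity and \<open>L\<^sub>0 = [0]\<close>.  Treating the
  distinguished input like the others, and not asking the \<open>L\<^sub>i\<close> to be increasing, keeps the
  substitution laws free of case distinctions.
\<close>

definition wire :: "('c, 'o, 'x) operad_scheme \<Rightarrow> 'o \<Rightarrow> 'o list \<Rightarrow> nat list list \<Rightarrow> 'o" where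
  "wire P f gs Ls = relabel P (comp P f gs) (concat Ls)"

definition wirable ::
    "('c, 'o, 'x) operad_scheme \<Rightarrow> 'o \<Rightarrow> 'o list \<Rightarrow> nat list list \<Rightarrow> bool" where
  "wirable P f gs Ls \<longleftrightarrow>
     composable P f gs \<and> map length Ls = map (arity P) gs \<and>
     concat Ls \<in> permutations_of_set {..<length (concat Ls)}"

definition wire_args ::
    "('c, 'o, 'a, 'y) algebra_scheme \<Rightarrow> 'o list \<Rightarrow> nat list list \<Rightarrow> 'a list \<Rightarrow> 'a list" where
  "wire_args A gs Ls xs = map2 (\<lambda>g L. app A g (map ((!) xs) L)) gs Ls"

lemma wirable_lengths: "wirable P f gs Ls \<Longrightarrow> length Ls = length gs"
  by (metis length_map wirable_def)

context symmetric_operad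
begin

lemma arity_comp: "composable P f gs \<Longrightarrow> arity P (comp P f gs) = sum_list (map (arity P) gs)"
  by (simp add: arity_def[abs_def] inp_comp length_concat o_def)

lemma wirable_permutation:
  assumes "wirable P f gs Ls"
  shows "concat Ls \<in> permutations_of_set {..<arity P (comp P f gs)}"
    and "arity P (comp P f gs) = length (concat Ls)"
proof -
  show "arity P (comp P f gs) = length (concat Ls)"
    using assms by (simp add: wirable_def arity_comp length_concat)
  then show "concat Ls \<in> permutations_of_set {..<arity P (comp P f gs)}"
    using assms by (simp add: wirable_def)
qed

lemma arity_wire: "wirable P f gs Ls \<Longrightarrow> arity P (wire P f gs Ls) = length (concat Ls)"
  using wirable_permutation[of f gs Ls]
  by (simp add: wire_def arity_relabel comp_ops wirable_def)

lemma out_wire: "wirable P f gs Ls \<Longrightarrow> out P (wire P f gs Ls) = out P f"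
  using wirable_permutation[of f gs Ls]
  by (simp add: wire_def out_relabel comp_ops out_comp wirable_def)

text \<open>
  The colours read off at the positions \<open>L\<^sub>i\<close> are the input colours of \<open>g\<^sub>i\<close>.  The relabelling axiom
  only gives this for the concatenation of all the \<open>L\<^sub>i\<close>; equality of lengths splits it into pieces.
\<close>

lemma inp_wire:
  assumes w: "wirable P f gs Ls"
  shows "map (map ((!) (inp P (wire P f gs Ls)))) Ls = map (inp P) gs"
proof (rule concat_injective)
  have c: "composable P f gs" using w by (simp add: wirable_def)
  show "concat (map (map ((!) (inp P (wire P f gs Ls)))) Ls) = concat (map (inp P) gs)"
    using inp_relabel[OF comp_ops[OF c] wirable_permutation(1)[OF w]]
    by (simp add: wire_def inp_comp[OF c] flip: map_concat)
  show "length (map (map ((!) (inp P (wire P f gs Ls)))) Ls) = length (map (inp P) gs)"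
    using wirable_lengths[OF w] by simp
  have "length (Ls ! i) = length (inp P (gs ! i))" if "i < length gs" for i
    using w that wirable_lengths[OF w]
    by (metis arity_def nth_map wirable_def)
  then show "\<forall>(x, y) \<in> set (zip (map (map ((!) (inp P (wire P f gs Ls)))) Ls) (map (inp P) gs)).
      length x = length y"
    using wirable_lengths[OF w] by (auto simp: set_zip)
qed

text \<open>
  The inputs of the whole composite at the positions \<open>L\<^sub>i\<close> have the colours of the inputs of \<open>g\<^sub>i\<close>, so
  operations that fit the composite also fit each inner operation.
\<close>

lemma wire_composable:
  assumes w: "wirable P f gs Ls" and cv: "composable P (wire P f gs Ls) ps"
  shows "list_all2 (composable P) gs (map (map ((!) ps)) Ls)"
  unfolding list_all2_conv_all_nth
proof (intro conjI allI impI)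
  let ?W = "wire P f gs Ls"
  have lens: "length Ls = length gs" using wirable_lengths[OF w] .
  then show "length gs = length (map (map ((!) ps)) Ls)" by simp
  have outs: "map (out P) ps = inp P ?W" using cv by (simp add: composable_def)
  have "length ps = length (concat Ls)"
    using arg_cong[OF outs, of length] arity_wire[OF w] by (simp add: arity_def)
  then have "set (concat Ls) = {..<length ps}"
    using w by (simp add: wirable_def permutations_of_set_def)
  then have Lps: "j < length ps" if "L \<in> set Ls" "j \<in> set L" for j L
    using that by auto
  fix i assume i: "i < length gs"
  have "out P (ps ! j) = inp P ?W ! j" if "j < length ps" for j
    using nth_map[OF that, of "out P"] outs by simp
  then have "map (out P) (map ((!) ps) (Ls ! i)) = map ((!) (inp P ?W)) (Ls ! i)"
    using Lps[of "Ls ! i"] i lens by simp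
  also have "\<dots> = inp P (gs ! i)"
    using inp_wire[OF w] i lens by (metis (no_types, lifting) nth_map)
  finally have "map (out P) (map ((!) ps) (Ls ! i)) = inp P (gs ! i)" .
  moreover have "set (map ((!) ps) (Ls ! i)) \<subseteq> ops P"
    using Lps i lens cv by (force simp: composable_def)
  moreover have "gs ! i \<in> ops P" using w i by (auto simp: composable_def wirable_def)
  ultimately show "composable P (gs ! i) (map (map ((!) ps)) Ls ! i)"
    using i lens by (simp add: composable_def)
qed

text \<open>
  Associativity for wired composites.  Pulling the outer relabelling through the second
  composition turns it into a permutation of blocks; the second wiring sends the block of \<open>p\<^sub>j\<close> to
  \<open>K\<^sub>j\<close>, so the two relabellings combine to the concatenation of the lists \<open>K\<^sub>j\<close> in the order in
  which the \<open>L\<^sub>i\<close> mention \<open>j\<close>.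
\<close>

lemma wire_wire:
  assumes w: "wirable P f gs Ls" and v: "wirable P (wire P f gs Ls) ps Ks"
  defines "hs \<equiv> map2 (\<lambda>g L. comp P g (map ((!) ps) L)) gs Ls"
    and "Ms \<equiv> map (\<lambda>L. concat (map ((!) Ks) L)) Ls"
  shows "wirable P f hs Ms" and "wire P f hs Ms = wire P (wire P f gs Ls) ps Ks"
proof -
  let ?W = "wire P f gs Ls" and ?h = "comp P f gs" and ?B = "blocks (map (arity P) ps)"
  let ?\<sigma> = "concat Ls"
  have c: "composable P f gs" using w by (simp add: wirable_def)
  have cv: "composable P ?W ps" using v by (simp add: wirable_def)
  have \<sigma>: "?\<sigma> \<in> permutations_of_set {..<arity P ?h}" "arity P ?h = length ?\<sigma>"
    using wirable_permutation[OF w] by auto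
  have lens: "length Ls = length gs" "length Ks = length ps"
    using wirable_lengths[OF w] wirable_lengths[OF v] by simp_all
  have ps: "length ps = length ?\<sigma>"
    by (metis arity_def arity_wire composable_def cv length_map w)
  have \<sigma>ps: "?\<sigma> \<in> permutations_of_set {..<length ps}"
    using \<sigma> ps by simp
  have set\<sigma>: "set ?\<sigma> = {..<length ps}"
    using \<sigma>ps by (simp add: permutations_of_set_def)
  have Lps: "j < length ps" if "L \<in> set Ls" "j \<in> set L" for j L
    using that set\<sigma> by auto
  have c2: "list_all2 (composable P) gs (map (map ((!) ps)) Ls)"
    by (rule wire_composable[OF w cv])
  have hs: "hs = map2 (comp P) gs (map (map ((!) ps)) Ls)"
    by (simp add: hs_def zip_map2 case_prod_unfold)
  have hsn: "hs ! i = comp P (gs ! i) (map ((!) ps) (Ls ! i))"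
      "composable P (gs ! i) (map ((!) ps) (Ls ! i))" if "i < length gs" for i
    using that lens(1) c2 by (auto simp: hs_def list_all2_conv_all_nth)
  have lhs: "length hs = length gs" using lens by (simp add: hs_def)
  have chs: "composable P f hs"
    unfolding composable_def
  proof (intro conjI)
    show "f \<in> ops P" using c by (simp add: composable_def)
    show "set hs \<subseteq> ops P"
      using hsn comp_ops lhs by (auto simp: in_set_conv_nth)
    have "map (out P) hs = map (out P) gs"
      using hsn lhs by (auto intro!: nth_equalityI simp: out_comp)
    then show "map (out P) hs = inp P f" using c by (simp add: composable_def)
  qed
  have comp_h: "comp P ?h (map ((!) ps) ?\<sigma>) = comp P f hs"
    using comp_assoc[OF c c2] by (simp add: hs map_concat)
  have lenK: "map length Ks = map (arity P) ps" using v by (simp add: wirable_def)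
  have lenKn: "length (Ks ! j) = arity P (ps ! j)" if "j < length ps" for j
    using lenK lens that by (metis nth_map)
  have KB: "map ((!) (concat Ks)) (?B ! j) = Ks ! j" if "j < length ps" for j
    using map_nth_concat_block[OF lenK] that by simp
  have concat_Ms: "concat Ms = concat (map ((!) Ks) ?\<sigma>)"
    unfolding Ms_def by (induction Ls) simp_all
  have perm_Ks: "mset (map ((!) Ks) ?\<sigma>) = mset Ks" "mset (map ((!) ?B) ?\<sigma>) = mset ?B"
    using \<sigma>ps lens by (auto intro!: map_nth_permutation simp del: mset_map)
  have mset_Ms: "mset (concat Ms) = mset (concat Ks)"
    unfolding concat_Ms by (rule mset_concat_reorder[OF perm_Ks(1)])
  have permMs: "concat Ms \<in> permutations_of_set {..<length (concat Ms)}"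
    using v by (simp only: wirable_def permutations_of_lessThan_iff_mset mset_Ms
        mset_eq_length[OF mset_Ms])
  have "map length Ms = map (arity P) hs"
  proof (rule nth_equalityI)
    fix i assume "i < length (map length Ms)"
    then have i: "i < length gs" by (simp add: Ms_def lens)
    then have "map length Ms ! i = sum_list (map (\<lambda>j. length (Ks ! j)) (Ls ! i))"
      using lens by (simp add: Ms_def length_concat o_def)
    also have "\<dots> = sum_list (map (\<lambda>j. arity P (ps ! j)) (Ls ! i))"
      using lenKn Lps i lens by (metis (no_types, lifting) map_eq_conv nth_mem)
    also have "\<dots> = map (arity P) hs ! i"
      using hsn[OF i] i lhs by (simp add: arity_comp o_def)
    finally show "map length Ms ! i = map (arity P) hs ! i" .
  qed (simp add: Ms_def lens lhs)
  with chs permMs show wM: "wirable P f hs Ms" by (simp add: wirable_def)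
  let ?\<tau> = "concat (map ((!) ?B) ?\<sigma>)"
  have "comp P ?W ps = relabel P (comp P f hs) ?\<tau>"
    using comp_relabel_outer[OF comp_ops[OF c] \<sigma>(1)] cv comp_h by (simp add: wire_def)
  then have "wire P ?W ps Ks = relabel P (relabel P (comp P f hs) ?\<tau>) (concat Ks)"
    by (simp add: wire_def)
  also have "\<dots> = relabel P (comp P f hs) (map ((!) (concat Ks)) ?\<tau>)"
  proof (rule relabel_relabel)
    show "comp P f hs \<in> ops P" by (rule comp_ops[OF chs])
    have len: "arity P (comp P f hs) = length (concat Ks)"
      using wirable_permutation(2)[OF wM] mset_eq_length[OF mset_Ms] by simp
    show "concat Ks \<in> permutations_of_set {..<arity P (comp P f hs)}"
      using v len by (simp add: wirable_def)
    have "mset ?\<tau> = mset [0..<sum_list (map (arity P) ps)]"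
      using mset_concat_reorder[OF perm_Ks(2)] by (simp add: concat_blocks)
    then show "?\<tau> \<in> permutations_of_set {..<arity P (comp P f hs)}"
      by (simp add: permutations_of_lessThan_iff_mset len length_concat lenK)
  qed
  also have "map ((!) (concat Ks)) ?\<tau> = concat (map ((!) Ks) ?\<sigma>)"
    unfolding map_concat[of _ "map ((!) ?B) ?\<sigma>"] list.map_comp
    using KB set\<sigma> by (intro arg_cong[where f = concat] map_cong) auto
  finally show "wire P f hs Ms = wire P ?W ps Ks"
    by (simp add: wire_def concat_Ms)
qed

text \<open>
  Permuting the inputs of each inner operation and permuting the wiring list to match cancel
  out.  This is why every wired composite can be brought to the form with increasing lists that
  grafting demands.
\<close>

lemma wire_sort:
  assumes w: "wirable P f gs Ls"
  defines "hs \<equiv> map2 (\<lambda>g L. relabel P g (rank L)) gs Ls"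
  shows "wirable P f hs (map sort Ls)" and "wire P f hs (map sort Ls) = wire P f gs Ls"
proof -
  let ?B = "blocks (map (arity P) gs)"
  have c: "composable P f gs" using w by (simp add: wirable_def)
  have lens: "length Ls = length gs" using wirable_lengths[OF w] .
  have lenL: "map length Ls = map (arity P) gs" using w by (simp add: wirable_def)
  have lenLn: "length (Ls ! i) = arity P (gs ! i)" if "i < length gs" for i
    using lenL lens that by (metis nth_map)
  have "distinct (concat Ls)" using w by (simp add: wirable_def permutations_of_set_def)
  then have dist: "distinct L" if "L \<in> set Ls" for L
    using that by (simp add: distinct_concat_iff)
  have gsn: "gs ! i \<in> ops P" if "i < length gs" for i
    using that c by (auto simp: composable_def)
  have rnk: "rank (Ls ! i) \<in> permutations_of_set {..<arity P (gs ! i)}" if "i < length gs" for i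
    using rank_permutation[OF dist[of "Ls ! i"]] that lens lenLn by simp
  have hsn: "hs ! i = relabel P (gs ! i) (rank (Ls ! i))" if "i < length gs" for i
    using that lens by (simp add: hs_def)
  have lhs: "length hs = length gs" using lens by (simp add: hs_def)
  have chs: "composable P f hs"
    unfolding composable_def
  proof (intro conjI)
    show "f \<in> ops P" using c by (simp add: composable_def)
    show "set hs \<subseteq> ops P"
      using lhs hsn gsn rnk relabel_ops by (auto simp: in_set_conv_nth)
    have "map (out P) hs = map (out P) gs"
      using lhs hsn gsn rnk by (auto intro!: nth_equalityI simp: out_relabel)
    then show "map (out P) hs = inp P f" using c by (simp add: composable_def)
  qed
  have arhs: "map (arity P) hs = map (arity P) gs"
    using lhs hsn gsn rnk by (auto intro!: nth_equalityI simp: arity_relabel)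
  have mset_sort: "mset (concat (map sort Ls)) = mset (concat Ls)"
    by (rule mset_concat_cong) simp
  have perm_sort: "concat (map sort Ls) \<in> permutations_of_set {..<length (concat (map sort Ls))}"
    using w by (simp only: wirable_def permutations_of_lessThan_iff_mset mset_sort
        mset_eq_length[OF mset_sort])
  have "map length (map sort Ls) = map length Ls" by simp
  with chs perm_sort arhs lenL show "wirable P f hs (map sort Ls)"
    by (simp only: wirable_def simp_thms)
  let ?\<tau> = "concat (map2 (\<lambda>b js. map ((!) b) js) ?B (map rank Ls))"
  have "hs = map2 (relabel P) gs (map rank Ls)"
    by (simp add: hs_def zip_map2 case_prod_unfold)
  moreover have "list_all2 (\<lambda>g js. js \<in> permutations_of_set {..<arity P g}) gs (map rank Ls)"
    using rnk lens by (simp add: list_all2_conv_all_nth)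
  ultimately have "comp P f hs = relabel P (comp P f gs) ?\<tau>"
    using comp_relabel_inner[OF c] by simp
  then have "wire P f hs (map sort Ls) =
      relabel P (relabel P (comp P f gs) ?\<tau>) (concat (map sort Ls))"
    by (simp add: wire_def)
  also have "\<dots> = relabel P (comp P f gs) (map ((!) (concat (map sort Ls))) ?\<tau>)"
  proof (rule relabel_relabel)
    show "comp P f gs \<in> ops P" by (rule comp_ops[OF c])
    have len: "arity P (comp P f gs) = length (concat (map sort Ls))"
      using wirable_permutation(2)[OF w] mset_eq_length[OF mset_sort] by simp
    show "concat (map sort Ls) \<in> permutations_of_set {..<arity P (comp P f gs)}"
      using perm_sort len by simp
    have "mset ?\<tau> = mset (concat ?B)"
    proof (rule mset_concat_cong, rule nth_equalityI)
      fix i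
      assume "i < length (map mset (map2 (\<lambda>b js. map ((!) b) js) ?B (map rank Ls)))"
      then have i: "i < length gs" using lens by simp
      have "rank (Ls ! i) \<in> permutations_of_set {..<length (?B ! i)}"
        using rnk[OF i] i by (simp add: length_nth_blocks)
      from map_nth_permutation[OF this] i lens
      show "map mset (map2 (\<lambda>b js. map ((!) b) js) ?B (map rank Ls)) ! i = map mset ?B ! i"
        by simp
    qed (simp add: lens)
    then show "?\<tau> \<in> permutations_of_set {..<arity P (comp P f gs)}"
      by (simp add: permutations_of_lessThan_iff_mset concat_blocks arity_comp[OF c])
  qed
  also have "map ((!) (concat (map sort Ls))) ?\<tau> = concat Ls"
  proof -
    have "map (map ((!) (concat (map sort Ls)))) (map2 (\<lambda>b js. map ((!) b) js) ?B (map rank Ls)) = Ls"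
    proof (rule nth_equalityI)
      fix i
      assume "i < length (map (map ((!) (concat (map sort Ls))))
          (map2 (\<lambda>b js. map ((!) b) js) ?B (map rank Ls)))"
      then have i: "i < length gs" using lens by simp
      have len_sort: "map length (map sort Ls) = map (arity P) gs"
        using lenL by (simp add: o_def)
      have "map ((!) (concat (map sort Ls))) (?B ! i) = sort (Ls ! i)"
        using map_nth_concat_block[OF len_sort] i lens by simp
      moreover have "map ((!) (concat (map sort Ls))) (map ((!) (?B ! i)) (rank (Ls ! i))) =
          map ((!) (map ((!) (concat (map sort Ls))) (?B ! i))) (rank (Ls ! i))"
        using rnk[OF i] i length_nth_blocks[of i "map (arity P) gs"]
        by (auto simp: permutations_of_set_def)
      ultimately have "map ((!) (concat (map sort Ls))) (map ((!) (?B ! i)) (rank (Ls ! i))) = Ls ! i"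
        using map_sort_nth_rank[OF dist[of "Ls ! i"]] i lens by simp
      then show "map (map ((!) (concat (map sort Ls))))
          (map2 (\<lambda>b js. map ((!) b) js) ?B (map rank Ls)) ! i = Ls ! i"
        using i lens by simp
    qed (simp add: lens)
    then show ?thesis by (metis map_concat)
  qed
  finally show "wire P f hs (map sort Ls) = wire P f gs Ls"
    by (simp add: wire_def)
qed

end


section \<open>Evaluating wired composites in an algebra\<close>

context operad_algebra
begin

text \<open>
  The evaluation of a wired composite runs through \<open>wire_args A gs Ls xs\<close>, the list of the
  intermediate values \<open>g\<^sub>i(x\<^bsub>L\<^sub>i!0\<^esub>, x\<^bsub>L\<^sub>i!1\<^esub>, \<dots>)\<close>.
\<close>

lemma args_wire:
  assumes w: "wirable P f gs Ls" and xs: "args P A (wire P f gs Ls) xs"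
  shows "list_all2 (args P A) gs (map (map ((!) xs)) Ls)"
  unfolding list_all2_conv_all_nth
proof (intro conjI allI impI)
  let ?W = "wire P f gs Ls"
  have lens: "length Ls = length gs" using wirable_lengths[OF w] .
  then show "length gs = length (map (map ((!) xs)) Ls)" by simp
  have "set (concat Ls) = {..<length (inp P ?W)}"
    using w arity_wire[OF w] by (simp add: wirable_def permutations_of_set_def arity_def)
  then have Lps: "j < length (inp P ?W)" if "L \<in> set Ls" "j \<in> set L" for j L
    using that by auto
  fix i assume i: "i < length gs"
  have inp: "inp P (gs ! i) = map ((!) (inp P ?W)) (Ls ! i)"
    using inp_wire[OF w] i lens by (metis (no_types, lifting) nth_map)
  have "xs ! j \<in> elts A (inp P ?W ! j)" if "j \<in> set (Ls ! i)" for j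
    using Lps[OF _ that] xs i lens by (simp add: args_def list_all2_conv_all_nth)
  then have "args P A (gs ! i) (map ((!) xs) (Ls ! i))"
    by (simp add: args_def inp list.rel_map list.rel_refl_strong)
  then show "args P A (gs ! i) (map (map ((!) xs)) Ls ! i)"
    using i lens by simp
qed

lemma args_wire_args:
  assumes w: "wirable P f gs Ls" and xs: "args P A (wire P f gs Ls) xs"
  shows "args P A f (wire_args A gs Ls xs)"
proof -
  have c: "f \<in> ops P" "set gs \<subseteq> ops P" "map (out P) gs = inp P f"
    using w by (auto simp: wirable_def composable_def)
  have lens: "length Ls = length gs" using wirable_lengths[OF w] .
  have "app A (gs ! i) (map ((!) xs) (Ls ! i)) \<in> elts A (out P (gs ! i))" if "i < length gs" for i
    using that c(2) lens args_wire[OF w xs]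
    by (intro app_elts) (auto simp: list_all2_conv_all_nth)
  then show ?thesis
    using lens by (auto simp: args_def wire_args_def list_all2_conv_all_nth c(3)[symmetric])
qed

lemma app_wire:
  assumes w: "wirable P f gs Ls" and xs: "args P A (wire P f gs Ls) xs"
  shows "app A (wire P f gs Ls) xs = app A f (wire_args A gs Ls xs)"
proof -
  have c: "composable P f gs" using w by (simp add: wirable_def)
  have "app A (wire P f gs Ls) xs = app A (comp P f gs) (map ((!) xs) (concat Ls))"
    using app_relabel[OF comp_ops[OF c] wirable_permutation(1)[OF w]] xs by (simp add: wire_def)
  also have "\<dots> = app A f (map2 (app A) gs (map (map ((!) xs)) Ls))"
    using app_comp[OF c args_wire[OF w xs]] by (simp add: map_concat)
  finally show ?thesis by (simp add: wire_args_def zip_map2 case_prod_unfold o_def)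
qed

text \<open>
  The intermediate values satisfy the same two laws as the composites themselves.
\<close>

lemma wire_args_wire:
  assumes w: "wirable P f gs Ls" and v: "wirable P (wire P f gs Ls) ps Ks"
    and xs: "args P A (wire P (wire P f gs Ls) ps Ks) xs"
  shows "wire_args A (map2 (\<lambda>g L. comp P g (map ((!) ps) L)) gs Ls)
      (map (\<lambda>L. concat (map ((!) Ks) L)) Ls) xs = wire_args A gs Ls (wire_args A ps Ks xs)"
proof (rule nth_equalityI)
  have lens: "length Ls = length gs" "length Ks = length ps"
    using wirable_lengths[OF w] wirable_lengths[OF v] by simp_all
  let ?hs = "map2 (\<lambda>g L. comp P g (map ((!) ps) L)) gs Ls"
    and ?Ms = "map (\<lambda>L. concat (map ((!) Ks) L)) Ls"
  show "length (wire_args A ?hs ?Ms xs) = length (wire_args A gs Ls (wire_args A ps Ks xs))"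
    by (simp add: wire_args_def lens)
  fix i assume "i < length (wire_args A ?hs ?Ms xs)"
  then have i: "i < length gs" by (simp add: wire_args_def lens)
  have cv: "composable P (wire P f gs Ls) ps" using v by (simp add: wirable_def)
  have "length ps = length (concat Ls)"
    using cv arity_wire[OF w] by (metis arity_def composable_def length_map)
  then have "set (concat Ls) = {..<length ps}"
    using w by (simp add: wirable_def permutations_of_set_def)
  then have Lps: "j < length ps" if "j \<in> set (Ls ! i)" for j
    using that i lens by auto
  let ?L = "Ls ! i"
  have "composable P (gs ! i) (map ((!) ps) ?L)"
    using wire_composable[OF w cv] i lens by (simp add: list_all2_conv_all_nth)
  moreover have "list_all2 (args P A) (map ((!) ps) ?L) (map (\<lambda>j. map ((!) xs) (Ks ! j)) ?L)"
    using args_wire[OF v xs] Lps lens by (simp add: list_all2_conv_all_nth)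
  ultimately have "app A (comp P (gs ! i) (map ((!) ps) ?L))
        (concat (map (\<lambda>j. map ((!) xs) (Ks ! j)) ?L)) =
      app A (gs ! i) (map2 (app A) (map ((!) ps) ?L) (map (\<lambda>j. map ((!) xs) (Ks ! j)) ?L))"
    by (rule app_comp)
  also have "concat (map (\<lambda>j. map ((!) xs) (Ks ! j)) ?L) = map ((!) xs) (concat (map ((!) Ks) ?L))"
    by (simp add: map_concat o_def)
  also have "map2 (app A) (map ((!) ps) ?L) (map (\<lambda>j. map ((!) xs) (Ks ! j)) ?L) =
      map ((!) (wire_args A ps Ks xs)) ?L"
    using Lps lens by (intro nth_equalityI) (auto simp: wire_args_def)
  finally show "wire_args A ?hs ?Ms xs ! i = wire_args A gs Ls (wire_args A ps Ks xs) ! i"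
    using i lens by (simp add: wire_args_def)
qed

lemma wire_args_sort:
  assumes w: "wirable P f gs Ls" and xs: "args P A (wire P f gs Ls) xs"
  shows "wire_args A (map2 (\<lambda>g L. relabel P g (rank L)) gs Ls) (map sort Ls) xs =
    wire_args A gs Ls xs"
proof (rule nth_equalityI)
  have lens: "length Ls = length gs" using wirable_lengths[OF w] .
  let ?hs = "map2 (\<lambda>g L. relabel P g (rank L)) gs Ls"
  show "length (wire_args A ?hs (map sort Ls) xs) = length (wire_args A gs Ls xs)"
    by (simp add: wire_args_def lens)
  fix i assume "i < length (wire_args A ?hs (map sort Ls) xs)"
  then have i: "i < length gs" by (simp add: wire_args_def lens)
  let ?L = "Ls ! i"
  have dist: "distinct ?L"
    using w i lens by (auto simp: wirable_def permutations_of_set_def distinct_concat_iff)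
  have "length ?L = arity P (gs ! i)"
    using w i lens by (metis nth_map wirable_def)
  then have rnk: "rank ?L \<in> permutations_of_set {..<arity P (gs ! i)}"
    using rank_permutation[OF dist] by simp
  have "args P A (wire P f ?hs (map sort Ls)) xs"
    using xs wire_sort(2)[OF w] by simp
  from args_wire[OF wire_sort(1)[OF w] this]
  have "args P A (relabel P (gs ! i) (rank ?L)) (map ((!) xs) (sort ?L))"
    using i lens by (simp add: list_all2_conv_all_nth)
  moreover have "gs ! i \<in> ops P" using w i by (auto simp: wirable_def composable_def)
  ultimately have "app A (relabel P (gs ! i) (rank ?L)) (map ((!) xs) (sort ?L)) =
      app A (gs ! i) (map ((!) (map ((!) xs) (sort ?L))) (rank ?L))"
    using app_relabel rnk by blast
  also have "map ((!) (map ((!) xs) (sort ?L))) (rank ?L) =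
      map ((!) xs) (map ((!) (sort ?L)) (rank ?L))"
    using rank_permutation[OF dist] by (auto simp: permutations_of_set_def)
  also have "\<dots> = map ((!) xs) ?L"
    using map_sort_nth_rank[OF dist] by simp
  finally show "wire_args A ?hs (map sort Ls) xs ! i = wire_args A gs Ls xs ! i"
    using i lens by (simp add: wire_args_def)
qed

end


section \<open>Grafting and composition of morphisms\<close>

lemma zero_Cons_permutation_iff:
  "0 # xs \<in> permutations_of_set {..<Suc n} \<longleftrightarrow> xs \<in> permutations_of_set {1..<Suc n}"
proof -
  define B where "B = {1..<Suc n}"
  have "{..<Suc n} = insert 0 B" "0 \<notin> B" by (auto simp: B_def)
  then show ?thesis
    unfolding permutations_of_set_def B_def[symmetric]
    using insert_ident[of 0 "set xs" B] by auto
qed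

lemma graft_eq_wire: "graft P f gs jss = wire P f (ident P (hd (inp P f)) # gs) ([0] # jss)"
  by (simp add: graft_def wire_def)

lemma graftable_entries:
  assumes "graftable P f gs jss N" "js \<in> set jss" "j \<in> set js"
  shows "1 \<le> j"
proof -
  have "set (concat jss) = {1..<N}"
    using assms(1) by (simp add: graftable_def permutations_of_set_def)
  moreover have "j \<in> set (concat jss)" using assms(2,3) by auto
  ultimately show "1 \<le> j" by auto
qed

lemma graftable_lengths: "graftable P f gs jss N \<Longrightarrow> length jss = length gs"
  by (metis graftable_def length_map)

context symmetric_operad
begin

lemma hd_inp_colour: "f \<in> ops P \<Longrightarrow> arity P f \<ge> 1 \<Longrightarrow> hd (inp P f) \<in> colours P"
  using inp_colours[of f] by (cases "inp P f") (auto simp: arity_def)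

text \<open>
  The list \<open>[0]\<close> takes up the position \<open>0\<close>, so that \<open>{..<N}\<close> is left with \<open>{1..<N}\<close> for the other
  lists; the arity \<open>N\<close> is determined by their total length.
\<close>

lemma graftable_iff_wirable:
  "graftable P f gs jss N \<longleftrightarrow>
     arity P f \<ge> 1 \<and> (\<forall>js\<in>set jss. sorted_wrt (<) js) \<and> N = Suc (length (concat jss)) \<and>
     wirable P f (ident P (hd (inp P f)) # gs) ([0] # jss)"
proof -
  have perm: "N \<ge> 1 \<and> concat jss \<in> permutations_of_set {1..<N} \<longleftrightarrow>
      N = Suc (length (concat jss)) \<and>
      0 # concat jss \<in> permutations_of_set {..<Suc (length (concat jss))}"
  proof -
    have "N = Suc (length (concat jss))" if "N \<ge> 1" "concat jss \<in> permutations_of_set {1..<N}"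
    proof -
      have "length (concat jss) = card {1..<N}"
        using that(2) by (rule length_finite_permutations_of_set)
      then show ?thesis using that(1) by simp
    qed
    then show ?thesis by (auto simp: zero_Cons_permutation_iff)
  qed
  have "(f \<in> ops P \<and> arity P f \<ge> 1 \<and> set gs \<subseteq> ops P \<and> map (out P) gs = tl (inp P f) \<and>
        map length jss = map (arity P) gs) \<longleftrightarrow>
      arity P f \<ge> 1 \<and> composable P f (ident P (hd (inp P f)) # gs) \<and>
        map length ([0] # jss) = map (arity P) (ident P (hd (inp P f)) # gs)"
  proof (cases "f \<in> ops P \<and> arity P f \<ge> 1")
    case True
    then have "hd (inp P f) \<in> colours P" by (simp add: hd_inp_colour)
    with True show ?thesis
      by (cases "inp P f")
        (auto simp: composable_def arity_def ident_ops inp_ident out_ident)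
  qed (auto simp: composable_def)
  with perm show ?thesis
    unfolding graftable_def wirable_def by auto
qed

lemma graft_typing:
  assumes "graftable P f gs jss N"
  shows "hd (inp P (graft P f gs jss)) = hd (inp P f)"
    and "arity P (graft P f gs jss) = N"
    and "out P (graft P f gs jss) = out P f"
proof -
  have w: "wirable P f (ident P (hd (inp P f)) # gs) ([0] # jss)" "arity P f \<ge> 1" "f \<in> ops P"
    using assms graftable_iff_wirable by (auto simp: graftable_def)
  show ar: "arity P (graft P f gs jss) = N"
    using assms arity_wire[OF w(1)] by (simp add: graft_eq_wire graftable_iff_wirable)
  have "inp P (graft P f gs jss) ! 0 = hd (inp P f)"
    using inp_wire[OF w(1)] inp_ident[OF hd_inp_colour[OF w(3,2)]] by (simp add: graft_eq_wire)
  moreover have "inp P (graft P f gs jss) \<noteq> []"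
    using ar assms by (auto simp: arity_def graftable_def)
  ultimately show "hd (inp P (graft P f gs jss)) = hd (inp P f)"
    by (simp add: hd_conv_nth)
  show "out P (graft P f gs jss) = out P f"
    using out_wire[OF w(1)] by (simp add: graft_eq_wire)
qed

text \<open>
  Once the identity on the distinguished input and its list \<open>[0]\<close> are put in front, composition of
  morphisms is the substitution of \<open>wire_wire\<close> followed by the sorting of \<open>wire_sort\<close>.  Adding the
  front entry also turns the lookups at \<open>j - 1\<close> into lookups at \<open>j\<close>, as all entries of the \<open>jss\<close>
  are positive.
\<close>

lemma T_comp_eq_sorted_wire:
  fixes ps :: "'o list" and kss :: "nat list list"
  assumes g: "graftable P f qs jss N"
  defines "e \<equiv> ident P (hd (inp P f))"
  defines "hs \<equiv> map2 (\<lambda>g L. comp P g (map ((!) (e # ps)) L)) (e # qs) ([0] # jss)"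
    and "Ms \<equiv> map (\<lambda>L. concat (map ((!) ([0] # kss)) L)) ([0] # jss)"
    and "d \<equiv> T_comp P (qs, jss) (ps, kss)"
  shows "e # fst d = map2 (\<lambda>h L. relabel P h (rank L)) hs Ms" and "[0] # snd d = map sort Ms"
proof -
  have c: "hd (inp P f) \<in> colours P"
    using g by (auto simp: graftable_def intro: hd_inp_colour)
  then have e: "comp P e [e] = e" "relabel P e (rank [0]) = e"
    using comp_ident_left[of e] relabel_id[of e]
    by (simp_all add: e_def ident_ops out_ident inp_ident arity_def rank_singleton)
  have ps: "map ((!) (e # ps)) js = map (\<lambda>j. ps ! (j - 1)) js"
    "map ((!) ([0] # kss)) js = map (\<lambda>j. kss ! (j - 1)) js" if "js \<in> set jss" for js
    using graftable_entries[OF g that] by (auto simp: nth_Cons')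
  have hs: "hs = e # map2 (\<lambda>q js. comp P q (map (\<lambda>j. ps ! (j - 1)) js)) qs jss"
    unfolding hs_def using e by (auto simp: ps dest: set_zip_rightD)
  have Ms: "Ms = [0] # map (\<lambda>js. concat (map (\<lambda>j. kss ! (j - 1)) js)) jss"
    unfolding Ms_def by (auto simp: ps)
  show "e # fst d = map2 (\<lambda>h L. relabel P h (rank L)) hs Ms" "[0] # snd d = map sort Ms"
    unfolding hs Ms d_def using e by (simp_all add: T_comp_def Let_def)
qed

lemma graft_T_comp:
  assumes g: "graftable P f qs jss N" and k: "graftable P (graft P f qs jss) ps kss M"
    and d: "T_comp P (qs, jss) (ps, kss) = (hs, Ms)"
  shows "graftable P f hs Ms M" and "graft P f hs Ms = graft P (graft P f qs jss) ps kss"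
proof -
  let ?e = "ident P (hd (inp P f))" and ?t = "graft P f qs jss"
  let ?hs = "map2 (\<lambda>g L. comp P g (map ((!) (?e # ps)) L)) (?e # qs) ([0] # jss)"
    and ?Ms = "map (\<lambda>L. concat (map ((!) ([0] # kss)) L)) ([0] # jss)"
  have w: "wirable P f (?e # qs) ([0] # jss)" and ar: "arity P f \<ge> 1"
    using g by (auto simp: graftable_iff_wirable)
  have t: "?t = wire P f (?e # qs) ([0] # jss)" by (rule graft_eq_wire)
  have v: "wirable P (wire P f (?e # qs) ([0] # jss)) (?e # ps) ([0] # kss)"
    using k graft_typing(1)[OF g] unfolding graftable_iff_wirable t by auto
  note ww = wire_wire[OF w v]
  note d' = T_comp_eq_sorted_wire[OF g, of ps kss, unfolded d fst_conv snd_conv]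
  have wf: "wirable P f (?e # hs) ([0] # Ms)"
    unfolding d' by (rule wire_sort(1)[OF ww(1)])
  have eq: "wire P f (?e # hs) ([0] # Ms) = wire P ?t (?e # ps) ([0] # kss)"
    unfolding d' wire_sort(2)[OF ww(1)] ww(2) t ..
  show gr: "graft P f hs Ms = graft P ?t ps kss"
    using eq graft_typing(1)[OF g] by (simp only: graft_eq_wire[of _ f hs] graft_eq_wire[of _ ?t])
  have "sorted_wrt (<) L" if L: "L \<in> set Ms" for L
  proof -
    have "distinct (concat ([0] # Ms))" using wf by (simp add: wirable_def permutations_of_set_def)
    then have "distinct L" using L by (simp add: distinct_concat_iff)
    moreover have "L \<in> set (map sort ?Ms)" using L unfolding d'(2)[symmetric] by simp
    then have "sorted L" by auto
    ultimately show ?thesis by (simp add: strict_sorted_iff)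
  qed
  moreover have "M = Suc (length (concat Ms))"
    using arity_wire[OF wf] graft_typing(2)[OF k] gr by (simp add: graft_eq_wire[of _ f hs])
  ultimately show "graftable P f hs Ms M"
    using wf ar by (simp add: graftable_iff_wirable)
qed

end

context operad_algebra
begin

lemma wire_args_graft:
  assumes g: "graftable P r qs jss N" and s: "s \<in> elts A (hd (inp P r))"
  shows "wire_args A (ident P (hd (inp P r)) # qs) ([0] # jss) (s # ys) =
    s # map2 (\<lambda>q js. app A q (map (\<lambda>j. ys ! (j - 1)) js)) qs jss"
proof -
  have ys: "map ((!) (s # ys)) js = map (\<lambda>j. ys ! (j - 1)) js" if "js \<in> set jss" for js
    using graftable_entries[OF g that] by (auto simp: nth_Cons')
  have "app A (ident P (hd (inp P r))) [s] = s"
    using g s by (intro app_ident hd_inp_colour) (auto simp: graftable_def)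
  then show ?thesis
    by (auto simp: wire_args_def ys dest: set_zip_rightD)
qed

lemma T_mor_iff_wire_args:
  assumes s: "s \<in> elts A (hd (inp P r))"
  shows "(qs, jss) \<in> T_mor P A (r, xs) (t, ys) \<longleftrightarrow>
    graftable P r qs jss (arity P t) \<and> t = graft P r qs jss \<and>
    s # xs = wire_args A (ident P (hd (inp P r)) # qs) ([0] # jss) (s # ys)"
  using wire_args_graft[OF _ s] by (auto simp: T_mor_def)

lemma T_obj_hd: "(r, xs) \<in> T_obj P A c s c' s' \<Longrightarrow> hd (inp P r) = c"
  by (auto simp: T_obj_def)

text \<open>
  The elements attached to the source of a morphism are obtained by evaluating the inner operations
  on those of the target, so composability is the compatibility of \<open>wire_args\<close> with substitution and
  sorting.
\<close>

lemma T_comp_in_T_mor: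
  assumes s: "s \<in> elts A c"
    and X: "X \<in> T_obj P A c s c' s'" and Y: "Y \<in> T_obj P A c s c' s'"
    and Z: "Z \<in> T_obj P A c s c' s'"
    and u: "u \<in> T_mor P A X Y" and v: "v \<in> T_mor P A Y Z"
  shows "T_comp P u v \<in> T_mor P A X Z"
proof -
  obtain r xs t ys z zs where XYZ: "X = (r, xs)" "Y = (t, ys)" "Z = (z, zs)"
    by (metis surj_pair)
  obtain qs jss ps kss where uv: "u = (qs, jss)" "v = (ps, kss)"
    by (metis surj_pair)
  obtain hs Ms where d: "T_comp P (qs, jss) (ps, kss) = (hs, Ms)"
    by (metis surj_pair)
  have c: "hd (inp P r) = c" "hd (inp P t) = c"
    using X Y XYZ T_obj_hd by auto
  let ?e = "ident P c"
  have g: "graftable P r qs jss (arity P t)" "t = graft P r qs jss"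
    and xs: "s # xs = wire_args A (?e # qs) ([0] # jss) (s # ys)"
    using u s T_mor_iff_wire_args[of s r] by (auto simp: XYZ uv c)
  have k: "graftable P t ps kss (arity P z)" "z = graft P t ps kss"
    and ys: "s # ys = wire_args A (?e # ps) ([0] # kss) (s # zs)"
    using v s T_mor_iff_wire_args[of s t] by (auto simp: XYZ uv c)
  have w: "wirable P r (?e # qs) ([0] # jss)" "t = wire P r (?e # qs) ([0] # jss)"
    using g(1) graftable_iff_wirable graft_eq_wire[of P r qs jss] c g(2) by auto
  have v: "wirable P (wire P r (?e # qs) ([0] # jss)) (?e # ps) ([0] # kss)"
    using k(1) graftable_iff_wirable c w(2) by auto
  have z: "z = wire P (wire P r (?e # qs) ([0] # jss)) (?e # ps) ([0] # kss)"
    using k(2) graft_eq_wire[of P t ps kss] c w(2) by simp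
  have zs: "args P A z (s # zs)" using Z by (simp add: XYZ T_obj_def)
  let ?hs = "map2 (\<lambda>g L. comp P g (map ((!) (?e # ps)) L)) (?e # qs) ([0] # jss)"
    and ?Ms = "map (\<lambda>L. concat (map ((!) ([0] # kss)) L)) ([0] # jss)"
  note ww = wire_wire[OF w(1) v]
  note d' = T_comp_eq_sorted_wire[OF g(1), of ps kss, unfolded d fst_conv snd_conv c]
  have "s # xs = wire_args A ?hs ?Ms (s # zs)"
    unfolding xs ys using wire_args_wire[OF w(1) v] zs z by simp
  also have "\<dots> = wire_args A (?e # hs) ([0] # Ms) (s # zs)"
    unfolding d' using wire_args_sort[OF ww(1)] ww(2) zs z by simp
  finally have "s # xs = wire_args A (?e # hs) ([0] # Ms) (s # zs)" .
  moreover have "graftable P r hs Ms (arity P z)" "z = graft P r hs Ms"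
    using graft_T_comp[OF g(1) k(1)[unfolded g(2)] d] k(2) g(2) by simp_all
  ultimately show ?thesis
    using T_mor_iff_wire_args[of s r] s by (simp add: XYZ uv d c)
qed

text \<open>
  The source of the lifted morphism carries the values of the inner operations \<open>qs\<close> on the elements
  \<open>ys\<close>; evaluating \<open>r\<close> on them gives \<open>s'\<close> because \<open>t\<close> does so on \<open>ys\<close>.
\<close>

lemma graft_lifts_to_T_mor:
  assumes s: "s \<in> elts A c" and Y: "(t, ys) \<in> T_obj P A c s c' s'"
    and g: "graftable P r qs jss (arity P t)" and t: "t = graft P r qs jss"
  obtains xs where "(r, xs) \<in> T_obj P A c s c' s'" "(qs, jss) \<in> T_mor P A (r, xs) (t, ys)"
proof -
  define xs where "xs = map2 (\<lambda>q js. app A q (map (\<lambda>j. ys ! (j - 1)) js)) qs jss"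
  have c: "hd (inp P r) = c"
    using graft_typing(1)[OF g] T_obj_hd[OF Y] t by simp
  have w: "wirable P r (ident P c # qs) ([0] # jss)" "t = wire P r (ident P c # qs) ([0] # jss)"
    using g graftable_iff_wirable graft_eq_wire[of P r qs jss] c t by auto
  have xs: "s # xs = wire_args A (ident P c # qs) ([0] # jss) (s # ys)"
    using wire_args_graft[OF g, of s] s by (simp add: c xs_def)
  have ys: "args P A (wire P r (ident P c # qs) ([0] # jss)) (s # ys)" "app A t (s # ys) = s'"
      "out P t = c'"
    using Y by (auto simp: T_obj_def simp flip: w(2))
  have "inp P r = c # tl (inp P r)"
    using g c by (cases "inp P r") (auto simp: graftable_def arity_def)
  then have "\<exists>cs. inp P r = c # cs" ..
  moreover have "r \<in> ops P" using g by (simp add: graftable_def)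
  moreover have "out P r = c'" using graft_typing(3)[OF g] ys(3) t by simp
  moreover have "args P A r (s # xs)"
    unfolding xs by (rule args_wire_args[OF w(1) ys(1)])
  moreover have "app A r (s # xs) = s'"
    using app_wire[OF w(1) ys(1)] ys(2) w(2) by (simp add: xs)
  ultimately have "(r, xs) \<in> T_obj P A c s c' s'" by (simp add: T_obj_def)
  moreover have "(qs, jss) \<in> T_mor P A (r, xs) (t, ys)"
    using g t by (simp add: T_mor_def xs_def)
  ultimately show thesis by (rule that)
qed

end


section \<open>Initial objects from canonical decompositions\<close>

lemma components_cases:
  assumes "K \<in> components C"
  obtains X where "X \<in> Obj C" "K = connected_objs C `` {X}"
  using assms unfolding components_def by (rule quotientE)

lemma connected_objs_closed:
  assumes "(X, Y) \<in> connected_objs C" "X \<in> Obj C"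
  shows "Y \<in> Obj C"
proof -
  have "equivclp (\<lambda>X Y. X \<in> Obj C \<and> Y \<in> Obj C \<and> Hom C X Y \<noteq> {}) X Y"
    using assms(1) by (simp add: connected_objs_def)
  then show ?thesis by (induction rule: equivclp_induct) (use assms(2) in auto)
qed

lemma connected_objsI:
  "X \<in> Obj C \<Longrightarrow> Y \<in> Obj C \<Longrightarrow> h \<in> Hom C X Y \<Longrightarrow> (X, Y) \<in> connected_objs C"
  unfolding connected_objs_def by (auto intro!: r_into_equivclp)

lemma connected_objs_sym: "(X, Y) \<in> connected_objs C \<Longrightarrow> (Y, X) \<in> connected_objs C"
  unfolding connected_objs_def using equivclp_sym by fastforce

lemma connected_objs_trans:
  "(X, Y) \<in> connected_objs C \<Longrightarrow> (Y, Z) \<in> connected_objs C \<Longrightarrow> (X, Z) \<in> connected_objs C"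
  unfolding connected_objs_def using equivclp_trans by fastforce

text \<open>
  The members of \<open>S\<close> behave like the initial objects of their components: every object has
  exactly one arrow from \<open>S\<close>.  Along an arrow \<open>X \<rightarrow> Y\<close> the source in \<open>S\<close> does not change: composing
  with the arrow shows that the source of \<open>X\<close> is a source of \<open>Y\<close>, and sources are unique.
  So it is constant on each component.
\<close>

lemma component_has_initial:
  assumes comp: "\<And>X Y Z. \<lbrakk>X \<in> Obj C; Y \<in> Obj C; Z \<in> Obj C; Hom C X Y \<noteq> {}; Hom C Y Z \<noteq> {}\<rbrakk>
      \<Longrightarrow> Hom C X Z \<noteq> {}"
    and S: "S \<subseteq> Obj C"
    and ex: "\<And>X. X \<in> Obj C \<Longrightarrow> \<exists>I \<in> S. Hom C I X \<noteq> {}"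
    and uniq: "\<And>X I J u v. \<lbrakk>X \<in> Obj C; I \<in> S; J \<in> S; u \<in> Hom C I X; v \<in> Hom C J X\<rbrakk>
      \<Longrightarrow> I = J \<and> u = v"
    and K: "K \<in> components C"
  shows "\<exists>I. initial (full_subcategory C K) I"
proof -
  obtain X where X: "X \<in> Obj C" and K_eq: "K = connected_objs C `` {X}"
    using K by (rule components_cases)
  obtain I where I: "I \<in> S" "Hom C I X \<noteq> {}" using ex[OF X] by blast
  have IObj: "I \<in> Obj C" using I S by blast
  have source_eq: "Hom C I Y \<noteq> {} \<longleftrightarrow> Hom C I Z \<noteq> {}"
    if YZ: "Y \<in> Obj C" "Z \<in> Obj C" "Hom C Y Z \<noteq> {}" for Y Z
  proof
    assume "Hom C I Y \<noteq> {}"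
    then show "Hom C I Z \<noteq> {}" using comp IObj YZ by blast
  next
    assume IZ: "Hom C I Z \<noteq> {}"
    obtain J where J: "J \<in> S" "Hom C J Y \<noteq> {}" using ex[OF YZ(1)] by blast
    then have "Hom C J Z \<noteq> {}" using comp S YZ by blast
    then have "J = I" using uniq[OF YZ(2) J(1) I(1)] IZ by blast
    then show "Hom C I Y \<noteq> {}" using J by simp
  qed
  have arrow: "Hom C I Y \<noteq> {}" if "Y \<in> K" for Y
  proof -
    have "equivclp (\<lambda>X Y. X \<in> Obj C \<and> Y \<in> Obj C \<and> Hom C X Y \<noteq> {}) X Y"
      using that by (simp add: K_eq connected_objs_def)
    then show ?thesis
    proof (induction rule: equivclp_induct)
      case base
      show ?case by (rule I(2))
    next
      case (step Y Z)
      then show ?case using source_eq by blast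
    qed
  qed
  obtain h where "h \<in> Hom C I X" using I(2) by blast
  then have "(I, X) \<in> connected_objs C" by (rule connected_objsI[OF IObj X])
  then have "(X, I) \<in> connected_objs C" by (rule connected_objs_sym)
  then have "I \<in> K" by (simp add: K_eq)
  moreover have "\<exists>!h. h \<in> Hom C I Y" if "Y \<in> K" for Y
  proof -
    have "(X, Y) \<in> connected_objs C" using that by (simp add: K_eq)
    then have "Y \<in> Obj C" by (rule connected_objs_closed[OF _ X])
    then have "u = v" if "u \<in> Hom C I Y" "v \<in> Hom C I Y" for u v
      using uniq I(1) that by blast
    then show ?thesis using arrow[OF that] by blast
  qed
  ultimately have "initial (full_subcategory C K) I"
    by (simp add: initial_def full_subcategory_def)
  then show ?thesis ..
qed

text \<open>
  The objects whose operation lies in \<open>P'\<close> are the canonical sources: the decomposition of the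
  operation \<open>t\<close> of an object lifts to a morphism from such an object, and any morphism from such an
  object decomposes \<open>t\<close>.
\<close>

lemma (in operad_algebra) canonically_decomposable_imp_initial:
  assumes cd: "canonically_decomposable P"
    and s: "s \<in> elts A c" and K: "K \<in> components (T_Hom P A c s c' s')"
  shows "\<exists>I. initial (full_subcategory (T_Hom P A c s c' s') K) I"
proof -
  let ?D = "\<lambda>P' q d. case d of (q', qs, jss) \<Rightarrow>
      q' \<in> P' \<and> graftable P q' qs jss (arity P q) \<and> q = graft P q' qs jss"
  obtain P' where P': "\<forall>q \<in> ops P. arity P q \<ge> 1 \<longrightarrow> (\<exists>!d. ?D P' q d)"
    using cd unfolding canonically_decomposable_def by (elim exE conjE) (rule that)
  have decomp: "\<exists>q' qs jss. q' \<in> P' \<and> graftable P q' qs jss (arity P q) \<and> q = graft P q' qs jss"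
    if q: "q \<in> ops P" "arity P q \<ge> 1" for q
  proof -
    have "\<exists>d. ?D P' q d" using P' q by (intro ex1_implies_ex) simp
    then show ?thesis by (simp add: split_paired_Ex)
  qed
  have decomp_unique: "r = r' \<and> u = u'"
    if q: "q \<in> ops P" "arity P q \<ge> 1" and D: "?D P' q (r, u)" "?D P' q (r', u')" for q r u r' u'
  proof -
    have "\<exists>!d. ?D P' q d" using P' q by simp
    then obtain d where d: "\<forall>d'. ?D P' q d' \<longrightarrow> d' = d"
      by (elim ex1E) (rule that)
    have "(r, u) = (r', u')"
      by (rule trans[OF d[rule_format, OF D(1)] d[rule_format, OF D(2), symmetric]])
    then show ?thesis by (rule Pair_inject) (rule conjI)
  qed
  let ?C = "T_Hom P A c s c' s'" and ?Ob = "T_obj P A c s c' s'"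
  have C: "Obj ?C = ?Ob" "Hom ?C = T_mor P A" by (simp_all add: T_Hom_def)
  have ops: "t \<in> ops P" "arity P t \<ge> 1" if "(t, ys) \<in> ?Ob" for t ys
    using that by (auto simp: T_obj_def arity_def)
  show ?thesis
  proof (rule component_has_initial[OF _ _ _ _ K])
    show "{I \<in> ?Ob. fst I \<in> P'} \<subseteq> Obj ?C" by (auto simp: C)
  next
    fix X Y Z
    assume "X \<in> Obj ?C" "Y \<in> Obj ?C" "Z \<in> Obj ?C" "Hom ?C X Y \<noteq> {}" "Hom ?C Y Z \<noteq> {}"
    then show "Hom ?C X Z \<noteq> {}" using T_comp_in_T_mor[OF s, of X c' s' Y Z] by (auto simp: C)
  next
    fix X assume "X \<in> Obj ?C"
    then obtain t ys where X: "X = (t, ys)" "(t, ys) \<in> ?Ob"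
      by (cases X) (auto simp: C)
    obtain q' qs jss where q': "q' \<in> P'"
        and g: "graftable P q' qs jss (arity P t)" "t = graft P q' qs jss"
      using decomp[OF ops[OF X(2)]] by blast
    obtain xs where "(q', xs) \<in> ?Ob" "(qs, jss) \<in> T_mor P A (q', xs) (t, ys)"
      by (rule graft_lifts_to_T_mor[OF s X(2) g])
    with q' show "\<exists>I \<in> {I \<in> ?Ob. fst I \<in> P'}. Hom ?C I X \<noteq> {}"
      unfolding C X(1) by force
  next
    fix X I J u v
    assume "X \<in> Obj ?C" and IJ: "I \<in> {I \<in> ?Ob. fst I \<in> P'}" "J \<in> {I \<in> ?Ob. fst I \<in> P'}"
      and uv: "u \<in> Hom ?C I X" "v \<in> Hom ?C J X"
    then obtain t ys where X: "X = (t, ys)" "(t, ys) \<in> ?Ob"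
      by (cases X) (auto simp: C)
    have "?D P' t (fst I, u)" "?D P' t (fst J, v)"
      using uv IJ unfolding C X(1) T_mor_def by (auto split: prod.splits)
    then have eq: "fst I = fst J" "u = v"
      using decomp_unique[OF ops[OF X(2)]] by blast+
    (* A morphism and the elements of its target determine the elements of its source. *)
    moreover have "snd I = snd J"
      using uv eq unfolding C X(1) T_mor_def by (auto split: prod.splits)
    ultimately show "I = J \<and> u = v" by (simp add: prod_eq_iff)
  qed
qed


section \<open>Canonical decompositions from initial objects\<close>

definition terminal_algebra :: "('c, 'o, 'a) algebra" where
  "terminal_algebra = \<lparr>elts = (\<lambda>_. {undefined}), app = (\<lambda>_ _. undefined)\<rparr>"

lemma terminal_algebra_simps [simp]:
  "elts terminal_algebra c = {undefined}" "app terminal_algebra f xs = undefined"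
  by (simp_all add: terminal_algebra_def)

context symmetric_operad
begin

lemma operad_algebra_terminal: "operad_algebra P terminal_algebra"
  by unfold_locales simp_all

lemma args_terminal:
  "args P terminal_algebra f xs \<longleftrightarrow> xs = replicate (arity P f) undefined"
  by (auto simp: args_def arity_def list_all2_conv_all_nth intro: nth_equalityI)

text \<open>
  An object of the terminal algebra's categories is determined by its operation; its list of
  elements is one shorter than the arity, since the distinguished input is not listed.
\<close>

definition terminal_obj :: "'o \<Rightarrow> 'o \<times> 'a list" where
  "terminal_obj q = (q, replicate (arity P q - 1) undefined)"

lemma T_obj_terminal:
  "T_obj P terminal_algebra c undefined c' undefined =
     terminal_obj ` {r \<in> ops P. arity P r \<ge> 1 \<and> hd (inp P r) = c \<and> out P r = c'}"
proof -
  have args: "args P terminal_algebra r (undefined # xs) \<longleftrightarrow>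
      arity P r \<ge> 1 \<and> (r, xs) = terminal_obj r" for r xs
    unfolding args_terminal terminal_obj_def by (cases "arity P r") simp_all
  have hd: "(\<exists>cs. inp P r = c # cs) \<longleftrightarrow> arity P r \<ge> 1 \<and> hd (inp P r) = c" for r
    by (cases "inp P r") (simp_all add: arity_def)
  have "(r, xs) \<in> T_obj P terminal_algebra c undefined c' undefined \<longleftrightarrow>
      r \<in> ops P \<and> arity P r \<ge> 1 \<and> hd (inp P r) = c \<and> out P r = c' \<and> (r, xs) = terminal_obj r"
    for r xs
    unfolding T_obj_def mem_Collect_eq prod.case args hd by simp blast
  then show ?thesis by (auto simp: terminal_obj_def)
qed

lemma T_mor_terminal:
  "(qs, jss) \<in> T_mor P terminal_algebra (terminal_obj r) (terminal_obj t) \<longleftrightarrow>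
     graftable P r qs jss (arity P t) \<and> t = graft P r qs jss"
proof -
  have "replicate (arity P r - 1) undefined =
      map2 (\<lambda>q js. app terminal_algebra q (map f js)) qs jss"
    if g: "graftable P r qs jss N" for N f
  proof -
    have "map (out P) qs = tl (inp P r)" using g by (simp add: graftable_def)
    then have "length qs = arity P r - 1" by (metis arity_def length_map length_tl)
    then show ?thesis
      using graftable_lengths[OF g] by (auto intro!: nth_equalityI)
  qed
  then show ?thesis by (auto simp: T_mor_def terminal_obj_def)
qed

text \<open>
  The set \<open>P'\<close> has to contain a single operation for each component: isomorphic initial objects with
  different operations would give one operation several decompositions.  Hence the initial object is
  chosen as a function of the component, and two operations in the same component get the same one.
\<close>

lemma initial_imp_canonically_decomposable:
  assumes init: "\<And>c c' K. \<lbrakk>c \<in> colours P; c' \<in> colours P;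
      K \<in> components (T_Hom P (terminal_algebra :: ('c, 'o, 'a) algebra) c undefined c' undefined)\<rbrakk> \<Longrightarrow>
      \<exists>I. initial (full_subcategory (T_Hom P (terminal_algebra :: ('c, 'o, 'a) algebra) c undefined c' undefined) K) I"
  shows "canonically_decomposable P"
proof -
  define C where "C q = T_Hom P (terminal_algebra :: ('c, 'o, 'a) algebra)
      (hd (inp P q)) undefined (out P q) undefined" for q
  define K where "K q = connected_objs (C q) `` {terminal_obj q}" for q
  define I where "I q = (SOME X. initial (full_subcategory (C q) (K q)) X)" for q
  define Q where "Q = {q \<in> ops P. arity P q \<ge> 1}"
  have objC: "Obj (C q) = terminal_obj `
      {r \<in> ops P. arity P r \<ge> 1 \<and> hd (inp P r) = hd (inp P q) \<and> out P r = out P q}" for q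
    by (simp add: C_def T_Hom_def T_obj_terminal)
  have HomC: "(qs, jss) \<in> Hom (C q) (terminal_obj r) (terminal_obj t) \<longleftrightarrow>
      graftable P r qs jss (arity P t) \<and> t = graft P r qs jss" for q qs jss r t
    by (simp add: C_def T_Hom_def T_mor_terminal)
  have q_obj: "terminal_obj q \<in> Obj (C q)" if "q \<in> Q" for q
    using that by (auto simp: objC Q_def)
  have I_initial: "initial (full_subcategory (C q) (K q)) (I q)" if q: "q \<in> Q" for q
  proof -
    have "K q \<in> components (C q)"
      unfolding components_def K_def using q_obj[OF q] by (rule quotientI)
    moreover have "hd (inp P q) \<in> colours P" "out P q \<in> colours P"
      using q hd_inp_colour out_colours by (auto simp: Q_def)
    ultimately have "\<exists>X. initial (full_subcategory (C q) (K q)) X"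
      using init unfolding C_def by blast
    then show ?thesis unfolding I_def by (rule someI_ex)
  qed
  have I_in: "(terminal_obj q, I q) \<in> connected_objs (C q)" if "q \<in> Q" for q
    using I_initial[OF that] by (simp add: initial_def full_subcategory_def K_def)
  have I_uniq: "\<exists>!h. h \<in> Hom (C q) (I q) (terminal_obj q)" if "q \<in> Q" for q
  proof -
    have "terminal_obj q \<in> K q" by (simp add: K_def connected_objs_def)
    then show ?thesis
      using I_initial[OF that] by (simp add: initial_def full_subcategory_def)
  qed
  have I_eq: "I q = terminal_obj (fst (I q))" "fst (I q) \<in> Q"
      "hd (inp P (fst (I q))) = hd (inp P q)" "out P (fst (I q)) = out P q" if "q \<in> Q" for q
  proof -
    have "I q \<in> Obj (C q)" using connected_objs_closed[OF I_in[OF that] q_obj[OF that]] .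
    then show "I q = terminal_obj (fst (I q))" "fst (I q) \<in> Q"
      "hd (inp P (fst (I q))) = hd (inp P q)" "out P (fst (I q)) = out P q"
      by (auto simp: objC terminal_obj_def Q_def)
  qed
  let ?P' = "(\<lambda>q. fst (I q)) ` Q"
  (* The base of a graft presentation of q with base in P' lies in the component of q, so it is
     the chosen initial object of that component. *)
  have graft_source: "r = fst (I q)"
    if q: "q \<in> Q" and r: "r \<in> ?P'"
      and g: "graftable P r qs jss (arity P q)" "q = graft P r qs jss" for q r qs jss
  proof -
    obtain p where p: "p \<in> Q" "r = fst (I p)" using r by blast
    have Ip: "I p = terminal_obj r" using I_eq(1)[OF p(1)] p(2) by simp
    have "hd (inp P q) = hd (inp P p)" "out P q = out P p"
      using graft_typing(1,3)[OF g(1)] g(2) I_eq(3,4)[OF p(1)] p(2) by auto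
    then have Cpq: "C q = C p" by (simp add: C_def)
    have "(terminal_obj r, terminal_obj q) \<in> connected_objs (C p)"
    proof (rule connected_objsI)
      show "terminal_obj r \<in> Obj (C p)"
        using connected_objs_closed[OF I_in[OF p(1)] q_obj[OF p(1)]] Ip by simp
      show "terminal_obj q \<in> Obj (C p)" using q_obj[OF q] Cpq by simp
      show "(qs, jss) \<in> Hom (C p) (terminal_obj r) (terminal_obj q)" using g by (simp add: HomC)
    qed
    then have pq: "(terminal_obj p, terminal_obj q) \<in> connected_objs (C p)"
      using I_in[OF p(1)] Ip connected_objs_trans by fastforce
    have "K q = K p"
      unfolding K_def Cpq
      using pq connected_objs_sym[OF pq] connected_objs_trans[where C = "C p"] by blast
    then have "I q = I p" by (simp add: I_def Cpq)
    then show ?thesis using p(2) by simp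
  qed
  show ?thesis
    unfolding canonically_decomposable_def
  proof (intro exI conjI ballI impI)
    show "?P' \<subseteq> ops P" using I_eq(2) by (auto simp: Q_def)
    fix q assume "q \<in> ops P" "arity P q \<ge> 1"
    then have q: "q \<in> Q" by (simp add: Q_def)
    obtain h where h: "h \<in> Hom (C q) (terminal_obj (fst (I q))) (terminal_obj q)"
        and h_uniq: "\<And>h'. h' \<in> Hom (C q) (terminal_obj (fst (I q))) (terminal_obj q) \<Longrightarrow> h' = h"
      using I_uniq[OF q] I_eq(1)[OF q] by metis
    show "\<exists>!d. case d of (q', qs, jss) \<Rightarrow>
        q' \<in> ?P' \<and> graftable P q' qs jss (arity P q) \<and> q = graft P q' qs jss"
    proof (rule ex1I[where a = "(fst (I q), h)"])
      show "case (fst (I q), h) of (q', qs, jss) \<Rightarrow>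
          q' \<in> ?P' \<and> graftable P q' qs jss (arity P q) \<and> q = graft P q' qs jss"
        using h q HomC[of "fst h" "snd h"] by (cases h) auto
    next
      fix d
      assume d: "case d of (q', qs, jss) \<Rightarrow>
          q' \<in> ?P' \<and> graftable P q' qs jss (arity P q) \<and> q = graft P q' qs jss"
      obtain r qs jss where d_eq: "d = (r, qs, jss)" by (rule prod_cases3)
      have g: "r \<in> ?P'" "graftable P r qs jss (arity P q)" "q = graft P r qs jss"
        using d unfolding d_eq prod.case by blast+
      have r: "r = fst (I q)" by (rule graft_source[OF q g])
      have "(qs, jss) \<in> Hom (C q) (terminal_obj (fst (I q))) (terminal_obj q)"
        unfolding HomC r[symmetric] using g(2,3) ..
      then have "(qs, jss) = h" by (rule h_uniq)
      then show "d = (fst (I q), h)" by (simp add: d_eq r)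
    qed
  qed
qed

end

theorem proposition4p5:
  fixes P :: "('c, 'o) operad"
  assumes "symmetric_operad P"
  shows "canonically_decomposable P \<longleftrightarrow>
    (\<forall>A :: ('c, 'o, 'a) algebra. operad_algebra P A \<longrightarrow>
      (\<forall>c \<in> colours P. \<forall>c' \<in> colours P. \<forall>s \<in> elts A c. \<forall>s' \<in> elts A c'.
        \<forall>K \<in> components (T_Hom P A c s c' s').
          \<exists>I. initial (full_subcategory (T_Hom P A c s c' s') K) I))"
proof
  assume cd: "canonically_decomposable P"
  show "\<forall>A :: ('c, 'o, 'a) algebra. operad_algebra P A \<longrightarrow>
      (\<forall>c \<in> colours P. \<forall>c' \<in> colours P. \<forall>s \<in> elts A c. \<forall>s' \<in> elts A c'.
        \<forall>K \<in> components (T_Hom P A c s c' s').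
          \<exists>I. initial (full_subcategory (T_Hom P A c s c' s') K) I)"
    by (intro allI impI ballI)
      (rule operad_algebra.canonically_decomposable_imp_initial[OF _ cd])
next
  assume init: "\<forall>A :: ('c, 'o, 'a) algebra. operad_algebra P A \<longrightarrow>
      (\<forall>c \<in> colours P. \<forall>c' \<in> colours P. \<forall>s \<in> elts A c. \<forall>s' \<in> elts A c'.
        \<forall>K \<in> components (T_Hom P A c s c' s').
          \<exists>I. initial (full_subcategory (T_Hom P A c s c' s') K) I)"
  show "canonically_decomposable P"
  proof (rule symmetric_operad.initial_imp_canonically_decomposable[OF assms])
    fix c c' K
    assume "c \<in> colours P" "c' \<in> colours P"
      "K \<in> components (T_Hom P (terminal_algebra :: ('c, 'o, 'a) algebra) c undefined c' undefined)"
    with init[rule_format, OF symmetric_operad.operad_algebra_terminal[OF assms]]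
    show "\<exists>I. initial (full_subcategory
        (T_Hom P (terminal_algebra :: ('c, 'o, 'a) algebra) c undefined c' undefined) K) I"
      by simp
  qed
qed

end
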